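(* Let $n\ge 1$, $K>0$, $M=\operatorname{diag}(m_1,\dots,m_n)$ and $D=\operatorname{diag}(d_1,\dots,d_n)$ with all $m_j>0$, $d_j>0$, let $\Omega\in\mathbb R^n$, and let $G=K e e^T\in\mathbb R^{n\times n}$, where $e\in\mathbb R^n$ is the vector of all ones. For $\rho,\sigma\in\mathbb R^n$ write $D_\rho=\operatorname{diag}(\rho_1,\dots,\rho_n)$ and $D_\sigma=\operatorname{diag}(\sigma_1,\dots,\sigma_n)$. Let $\mathbb I\subseteq\mathbb R$ be a compact interval with $t_0\in\mathbb I$. Consider the system for $x=[\omega^T,\rho^T,\sigma^T]^T:\mathbb I\to\mathbb R^{3n}$ $$(\mathrm A)\qquad M\dot\omega=\Omega-D\omega-D_\sigma G\rho+D_\rho G\sigma,\qquad \dot\rho=-D_\sigma\omega,\qquad \dot\sigma=D_\rho\omega,$$ and the system for $\tilde x=[\omega^T,\rho^T,\sigma^T,\mu^T]^T:\mathbb I\to\mathbb R^{4n}$ $$(\mathrm B)\qquad M\dot\omega=\Omega-D\omega-D_\sigma G\rho+D_\rho G\sigma,\qquad \dot\rho=-D_\sigma\omega,\qquad \dot\sigma=D_\rho\omega,\qquad 0=D_\rho\rho+D_\sigma\sigma-\mu,$$ together with initial conditions $x(t_0)=x_0$, where the components of $x_0$ satisfy $\rho_j(t_0)^2+\sigma_j(t_0)^2=1$ for $j=1,\dots,n$, and $\mu(t_0)=e$. (1) Under these initial conditions, $\tilde x=[\omega^T,\rho^T,\sigma^T,\mu^T]^T$ is a solution of $(\mathrm B)$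 if and only if $x=[\omega^T,\rho^T,\sigma^T]^T$ is a solution of $(\mathrm A)$ and $\mu$ is constant. (2) With $u=\Omega$, system $(\mathrm B)$ can be written as the port-Hamiltonian differential-algebraic system (pHDAE) $\tilde E\dot{\tilde x}=(\tilde J-\tilde R)\tilde Q\tilde x+\tilde B u$, where, in block form with respect to $(\omega,\rho,\sigma,\mu)$, $$\tilde E=\operatorname{diag}(M,I,I,0),\quad \tilde R=\operatorname{diag}(D,0,0,I),\quad \tilde B=\begin{bmatrix} I \\ 0 \\ 0 \\ 0 \end{bmatrix},$$ $$\tilde J=\begin{bmatrix} 0 & D_\sigma & -D_\rho & 0 \\ -D_\sigma & 0 & 0 & 0 \\ D_\rho & 0 & 0 & 0 \\ 0 & 0 & 0 & 0 \end{bmatrix},\quad \tilde Q=\begin{bmatrix} I & 0 & 0 & 0 \\ 0 & -G & 0 & 0 \\ 0 & 0 & -G & 0 \\ 0 & D_\rho & D_\sigma & -I \end{bmatrix}.$$ In particular, $\tilde J=-\tilde J^T$, the matrix $\tilde Q^T\tilde E=\tilde E^T\tilde Q$ is constant in time, $\tilde Q^T\tilde R\tilde Q\ge 0$, and the Hamiltonian is $$\mathcal H=\tfrac12\tilde x^T\tilde Q^T\tilde E\tilde x=\tfrac12\omega^TM\omega-\tfrac12\rho^TG\rho-\tfrac12\sigma^TG\sigma .$$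
   Context: The systems are reformulations of the standard Kuramoto model $m_j\ddot\theta_j+d_j\dot\theta_j=\Omega_j+K\sum_{k=1}^n\sin(\theta_k-\theta_j)$, $j=1,\dots,n$, with $\omega_j=\dot\theta_j$, $\rho_j=\cos\theta_j$, $\sigma_j=\sin\theta_j$. For a real symmetric matrix $W$, $W\ge0$ means that $W$ is positive semi-definite. Definition (pHDAE). A system $E\dot x=[(J-R)Q-ET]x+(B-P)u$, $y=(B+P)^TQx+(S+N)u$, with $E,Q\in C^1(\mathbb I,\mathbb R^{N_0,N_0})$, $J,R,T\in C^0(\mathbb I,\mathbb R^{N_0,N_0})$, $B,P\in C^0(\mathbb I,\mathbb R^{N_0,m})$, $S=S^T$, $N=-N^T\in C^0(\mathbb I,\mathbb R^{m,m})$, is called a pHDAE if: (i) for all $t\in\mathbb I$, $Q^TE=E^TQ\in C^1(\mathbb I,\mathbb R^{N_0,N_0})$ and $\frac{d}{dt}(Q^TE)=Q^T[ET-JQ]+[ET-JQ]^TQ$; (ii) the Hamiltonian $\mathcal H(x)=\frac12x^TQ^TEx$ satisfies $\mathcal H(x(t))\ge h_0$ for some $h_0\in\mathbb R$, uniformly for all $t\in\mathbb I$ and all solutions $x$ of the system; (iii) for all $t\in\mathbb I$ the matrix $W=\begin{bmatrix} Q^TRQ & Q^TP \\ P^TQ & S \end{bmatrix}$ is symmetric and positive semi-definite. For system (B), the state-dependent coefficients $\tilde J,\tilde Q$ are regarded as functions of $t$ by evaluating them along a solution; the definition is applied with $T=0$, $P=0$, $S=N=0$ (so the output is $y=\tilde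 B^T\tilde Q\tilde x$), and the solutions considered are those satisfying the stated initial conditions. *)

theory Defs
  imports "HOL-Analysis.Analysis"
begin

section \<open>Block vectors and matrices\<close>

text \<open>
  Vectors of dimension \<open>a + b\<close> are indexed by the sum type \<open>'a + 'b\<close>. A matrix is the vector
  of its rows, so stacking covers both vectors and matrices; \<open>A ||| B\<close> is the block row. Both
  operators nest to the right, hence four blocks indexed by \<open>'n\<close> yield the index type
  \<open>'n + 'n + 'n + 'n\<close>.
\<close>

definition stack :: "'c^'a::finite \<Rightarrow> 'c^'b::finite \<Rightarrow> 'c^('a + 'b)" (infixr "'/'/'/" 53)
  where "u /// v = (\<chi> k. case k of Inl i \<Rightarrow> u $ i | Inr j \<Rightarrow> v $ j)"

definition block_row :: "'c^'a::finite^'m::finite \<Rightarrow> 'c^'b::finite^'m \<Rightarrow> 'c^('a + 'b)^'m"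
    (infixr "|||" 54)
  where "A ||| B = (\<chi> i. (A $ i) /// (B $ i))"

definition upper :: "'c^('a::finite + 'b::finite) \<Rightarrow> 'c^'a"
  where "upper v = (\<chi> i. v $ Inl i)"

definition lower :: "'c^('a::finite + 'b::finite) \<Rightarrow> 'c^'b"
  where "lower v = (\<chi> j. v $ Inr j)"

definition diag :: "real^'n \<Rightarrow> real^'n^'n"
  where "diag v = (\<chi> i j. if i = j then v $ i else 0)"

definition pos_semidef :: "real^'n^'n \<Rightarrow> bool"
  where "pos_semidef W \<longleftrightarrow> transpose W = W \<and> (\<forall>v. 0 \<le> v \<bullet> (W *v v))"


section \<open>Continuously differentiable functions on an interval\<close>

text \<open>
  Derivatives are taken within \<open>I\<close>, that is, one-sided at the end points.
\<close>

definition has_C1_derivative_on ::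
    "(real \<Rightarrow> 'v::real_normed_vector) \<Rightarrow> (real \<Rightarrow> 'v) \<Rightarrow> real set \<Rightarrow> bool"
  where "has_C1_derivative_on f f' I \<longleftrightarrow>
    continuous_on I f' \<and> (\<forall>t\<in>I. (f has_vector_derivative f' t) (at t within I))"

definition C1_on :: "real set \<Rightarrow> (real \<Rightarrow> 'v::real_normed_vector) \<Rightarrow> bool"
  where "C1_on I f \<longleftrightarrow> (\<exists>f'. has_C1_derivative_on f f' I)"


section \<open>Port-Hamiltonian differential-algebraic systems\<close>

definition pHDAE_solution ::
    "real set \<Rightarrow> (real \<Rightarrow> real^'s^'s) \<Rightarrow> (real \<Rightarrow> real^'s^'s) \<Rightarrow> (real \<Rightarrow> real^'s^'s) \<Rightarrow>
     (real \<Rightarrow> real^'s^'s) \<Rightarrow> (real \<Rightarrow> real^'s^'s) \<Rightarrow> (real \<Rightarrow> real^'m^'s) \<Rightarrow> (real \<Rightarrow> real^'m^'s) \<Rightarrow>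
     (real \<Rightarrow> real^'m^'m) \<Rightarrow> (real \<Rightarrow> real^'m^'m) \<Rightarrow>
     (real \<Rightarrow> real^'m) \<Rightarrow> (real \<Rightarrow> real^'s) \<Rightarrow> (real \<Rightarrow> real^'m) \<Rightarrow> bool"
  where "pHDAE_solution I E Q J R T B P S N u x y \<longleftrightarrow>
    (\<exists>x'. has_C1_derivative_on x x' I \<and>
      (\<forall>t\<in>I.
        E t *v x' t = ((J t - R t) ** Q t - E t ** T t) *v x t + (B t - P t) *v u t \<and>
        y t = (transpose (B t + P t) ** Q t) *v x t + (S t + N t) *v u t))"

text \<open>
  The requirements on the coefficients alone: regularity, and conditions (i) and (iii) of the
  definition of a pHDAE.
\<close>

definition pHDAE_coefficients ::
    "real set \<Rightarrow> (real \<Rightarrow> real^'s^'s) \<Rightarrow> (real \<Rightarrow> real^'s^'s) \<Rightarrow> (real \<Rightarrow> real^'s^'s) \<Rightarrow>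
     (real \<Rightarrow> real^'s^'s) \<Rightarrow> (real \<Rightarrow> real^'s^'s) \<Rightarrow> (real \<Rightarrow> real^'m^'s) \<Rightarrow> (real \<Rightarrow> real^'m^'s) \<Rightarrow>
     (real \<Rightarrow> real^'m^'m) \<Rightarrow> (real \<Rightarrow> real^'m^'m) \<Rightarrow> bool"
  where "pHDAE_coefficients I E Q J R T B P S N \<longleftrightarrow>
    C1_on I E \<and> C1_on I Q \<and>
    continuous_on I J \<and> continuous_on I R \<and> continuous_on I T \<and>
    continuous_on I B \<and> continuous_on I P \<and> continuous_on I S \<and> continuous_on I N \<and>
    (\<forall>t\<in>I. transpose (S t) = S t \<and> transpose (N t) = - N t) \<and>
    (\<forall>t\<in>I. transpose (Q t) ** E t = transpose (E t) ** Q t) \<and>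
    has_C1_derivative_on (\<lambda>t. transpose (Q t) ** E t)
      (\<lambda>t. transpose (Q t) ** (E t ** T t - J t ** Q t)
         + transpose (E t ** T t - J t ** Q t) ** Q t) I \<and>
    (\<forall>t\<in>I. pos_semidef
      ((transpose (Q t) ** R t ** Q t ||| transpose (Q t) ** P t) ///
       (transpose (P t) ** Q t        ||| S t)))"

definition hamiltonian :: "real^'s^'s \<Rightarrow> real^'s^'s \<Rightarrow> real^'s \<Rightarrow> real"
  where "hamiltonian E Q x = 1/2 * (x \<bullet> ((transpose Q ** E) *v x))"

text \<open>
  Coefficients may depend on time and state. They become functions of time by evaluation along
  a trajectory; coefficients that ignore the state give the linear time-varying case.
\<close>

definition along :: "(real \<Rightarrow> real^'s \<Rightarrow> 'c) \<Rightarrow> (real \<Rightarrow> real^'s) \<Rightarrow> real \<Rightarrow> 'c"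
  where "along F x t = F t (x t)"

text \<open>
  The set \<open>X0\<close> contains the admissible values of the state at time \<open>t0\<close>: only solutions
  starting there are considered (\<open>X0 = UNIV\<close> means no restriction). The lower bound \<open>h0\<close> of
  the Hamiltonian is uniform over all of these solutions.
\<close>

definition pHDAE ::
    "real set \<Rightarrow> real \<Rightarrow> (real^'s) set \<Rightarrow>
     (real \<Rightarrow> real^'s \<Rightarrow> real^'s^'s) \<Rightarrow> (real \<Rightarrow> real^'s \<Rightarrow> real^'s^'s) \<Rightarrow>
     (real \<Rightarrow> real^'s \<Rightarrow> real^'s^'s) \<Rightarrow> (real \<Rightarrow> real^'s \<Rightarrow> real^'s^'s) \<Rightarrow>
     (real \<Rightarrow> real^'s \<Rightarrow> real^'s^'s) \<Rightarrow> (real \<Rightarrow> real^'s \<Rightarrow> real^'m^'s) \<Rightarrow>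
     (real \<Rightarrow> real^'s \<Rightarrow> real^'m^'s) \<Rightarrow> (real \<Rightarrow> real^'s \<Rightarrow> real^'m^'m) \<Rightarrow>
     (real \<Rightarrow> real^'s \<Rightarrow> real^'m^'m) \<Rightarrow> (real \<Rightarrow> real^'m) \<Rightarrow> bool"
  where "pHDAE I t0 X0 E Q J R T B P S N u \<longleftrightarrow>
    (let Sol = {x. x t0 \<in> X0 \<and> (\<exists>y. pHDAE_solution I
                (along E x) (along Q x) (along J x) (along R x) (along T x)
                (along B x) (along P x) (along S x) (along N x) u x y)}
     in (\<forall>x\<in>Sol. pHDAE_coefficients I
           (along E x) (along Q x) (along J x) (along R x) (along T x)
           (along B x) (along P x) (along S x) (along N x)) \<and>
        (\<exists>h0. \<forall>x\<in>Sol. \<forall>t\<in>I. h0 \<le> hamiltonian (along E x t) (along Q x t) (x t)))"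


section \<open>The reformulated Kuramoto model\<close>

text \<open>In the type \<open>real^'n\<close> the constant \<open>1\<close> is the vector of all ones.\<close>

definition coupling :: "real \<Rightarrow> real^'n^'n"
  where "coupling K = K *\<^sub>R (columnvector (1::real^'n) ** (rowvector (1::real^'n) :: real^'n^1))"

text \<open>
  In \<open>solves_A\<close> and \<open>solves_B\<close> the parameters \<open>m\<close> and \<open>d\<close> are the diagonals of \<open>M\<close> and \<open>D\<close>.
\<close>

definition solves_A ::
    "real set \<Rightarrow> real^'n \<Rightarrow> real^'n \<Rightarrow> real \<Rightarrow> real^'n \<Rightarrow>
     (real \<Rightarrow> real^'n) \<Rightarrow> (real \<Rightarrow> real^'n) \<Rightarrow> (real \<Rightarrow> real^'n) \<Rightarrow> bool"
  where "solves_A I m d K \<Omega> \<omega> \<rho> \<sigma> \<longleftrightarrow>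
    (\<exists>\<omega>' \<rho>' \<sigma>'.
      has_C1_derivative_on \<omega> \<omega>' I \<and> has_C1_derivative_on \<rho> \<rho>' I \<and> has_C1_derivative_on \<sigma> \<sigma>' I \<and>
      (\<forall>t\<in>I.
        diag m *v \<omega>' t = \<Omega> - diag d *v \<omega> t - diag (\<sigma> t) *v (coupling K *v \<rho> t)
                           + diag (\<rho> t) *v (coupling K *v \<sigma> t) \<and>
        \<rho>' t = - (diag (\<sigma> t) *v \<omega> t) \<and>
        \<sigma>' t = diag (\<rho> t) *v \<omega> t))"

definition solves_B ::
    "real set \<Rightarrow> real^'n \<Rightarrow> real^'n \<Rightarrow> real \<Rightarrow> real^'n \<Rightarrow>
     (real \<Rightarrow> real^'n) \<Rightarrow> (real \<Rightarrow> real^'n) \<Rightarrow> (real \<Rightarrow> real^'n) \<Rightarrow> (real \<Rightarrow> real^'n) \<Rightarrow> bool"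
  where "solves_B I m d K \<Omega> \<omega> \<rho> \<sigma> \<mu> \<longleftrightarrow>
    (\<exists>\<omega>' \<rho>' \<sigma>' \<mu>'.
      has_C1_derivative_on \<omega> \<omega>' I \<and> has_C1_derivative_on \<rho> \<rho>' I \<and>
      has_C1_derivative_on \<sigma> \<sigma>' I \<and> has_C1_derivative_on \<mu> \<mu>' I \<and>
      (\<forall>t\<in>I.
        diag m *v \<omega>' t = \<Omega> - diag d *v \<omega> t - diag (\<sigma> t) *v (coupling K *v \<rho> t)
                           + diag (\<rho> t) *v (coupling K *v \<sigma> t) \<and>
        \<rho>' t = - (diag (\<sigma> t) *v \<omega> t) \<and>
        \<sigma>' t = diag (\<rho> t) *v \<omega> t \<and>
        0 = diag (\<rho> t) *v \<rho> t + diag (\<sigma> t) *v \<sigma> t - \<mu> t))"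

definition initial_states :: "(real^('n::finite + 'n + 'n + 'n)) set"
  where "initial_states =
    {\<omega> /// \<rho> /// \<sigma> /// \<mu> | \<omega> \<rho> \<sigma> \<mu>. (\<forall>j. (\<rho> $ j)\<^sup>2 + (\<sigma> $ j)\<^sup>2 = 1) \<and> \<mu> = 1}"

definition E_tilde :: "real^'n \<Rightarrow> real^('n::finite + 'n + 'n + 'n)^('n + 'n + 'n + 'n)"
  where "E_tilde m =
    ((diag m ||| 0     ||| 0     ||| 0) ///
     (0      ||| mat 1 ||| 0     ||| 0) ///
     (0      ||| 0     ||| mat 1 ||| 0) ///
     (0      ||| 0     ||| 0     ||| 0))"

definition R_tilde :: "real^'n \<Rightarrow> real^('n::finite + 'n + 'n + 'n)^('n + 'n + 'n + 'n)"
  where "R_tilde d =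
    ((diag d ||| 0 ||| 0 ||| 0) ///
     (0      ||| 0 ||| 0 ||| 0) ///
     (0      ||| 0 ||| 0 ||| 0) ///
     (0      ||| 0 ||| 0 ||| mat 1))"

definition B_tilde :: "real^'n^('n::finite + 'n + 'n + 'n)"
  where "B_tilde = (mat 1 /// 0 /// 0 /// 0)"

definition J_tilde :: "real^'n \<Rightarrow> real^'n \<Rightarrow> real^('n::finite + 'n + 'n + 'n)^('n + 'n + 'n + 'n)"
  where "J_tilde \<rho> \<sigma> =
    ((0          ||| diag \<sigma> ||| - diag \<rho> ||| 0) ///
     (- diag \<sigma> ||| 0       ||| 0         ||| 0) ///
     (diag \<rho>   ||| 0       ||| 0         ||| 0) ///
     (0          ||| 0       ||| 0         ||| 0))"

definition Q_tilde ::
    "real \<Rightarrow> real^'n \<Rightarrow> real^'n \<Rightarrow> real^('n::finite + 'n + 'n + 'n)^('n + 'n + 'n + 'n)"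
  where "Q_tilde K \<rho> \<sigma> =
    ((mat 1 ||| 0            ||| 0            ||| 0) ///
     (0     ||| - coupling K ||| 0            ||| 0) ///
     (0     ||| 0            ||| - coupling K ||| 0) ///
     (0     ||| diag \<rho>       ||| diag \<sigma>       ||| - mat 1))"

definition rho_of :: "real^('n::finite + 'n + 'n + 'n) \<Rightarrow> real^'n"
  where "rho_of x = upper (lower x)"

definition sigma_of :: "real^('n::finite + 'n + 'n + 'n) \<Rightarrow> real^'n"
  where "sigma_of x = upper (lower (lower x))"

end

theory Submission
  imports Defs
begin

text \<open>
  Along solutions each \<open>\<rho>\<^sub>j\<^sup>2 + \<sigma>\<^sub>j\<^sup>2\<close> is a first integral. It therefore keeps its initial value 1,
  which makes the algebraic equation for \<open>\<mu>\<close> equivalent to \<open>\<mu>\<close> being constant, and which bounds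
  the potential part of the Hamiltonian from below by \<open>-K n\<^sup>2\<close>. The weights \<open>Q\<close> depend on
  the state only in the block row that \<open>E\<close> annihilates, so \<open>Q\<^sup>T E = diag (M, -G, -G, 0)\<close> is
  constant; skew-symmetry of \<open>J\<close> then gives condition (i).
\<close>

section \<open>Block calculus\<close>

lemma stack_nth [simp]: "(u /// v) $ Inl i = u $ i" "(u /// v) $ Inr j = v $ j"
  by (simp_all add: stack_def)

lemma block_row_nth [simp]: "(A ||| B) $ i = A $ i /// B $ i"
  by (simp add: block_row_def)

text \<open>Extensionality for a sum index type; with \<open>sum_UNIV_Plus\<close>, it reduces the
  block rules below to entrywise comparison.\<close>

lemma vec_sum_eq_iff:
  fixes u v :: "'c^('a::finite + 'b::finite)"
  shows "u = v \<longleftrightarrow> (\<forall>i. u $ Inl i = v $ Inl i) \<and> (\<forall>j. u $ Inr j = v $ Inr j)"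
  by (metis sum.exhaust vec_eq_iff)

lemma sum_UNIV_Plus:
  fixes f :: "'a::finite + 'b::finite \<Rightarrow> 'c::comm_monoid_add"
  shows "sum f UNIV = (\<Sum>i\<in>UNIV. f (Inl i)) + (\<Sum>j\<in>UNIV. f (Inr j))"
  by (simp add: sum.Plus flip: UNIV_Plus_UNIV)

lemma stack_eq_iff [simp]: "u /// v = u' /// v' \<longleftrightarrow> u = u' \<and> v = v'"
  by (auto simp: vec_sum_eq_iff vec_eq_iff)

lemma stack_upper_lower [simp]: "upper v /// lower v = v"
  by (simp add: vec_sum_eq_iff upper_def lower_def)

lemma upper_stack [simp]: "upper (u /// v) = u"
  and lower_stack [simp]: "lower (u /// v) = v"
  by (simp_all add: vec_eq_iff upper_def lower_def)

lemma block_row_stack [simp]: "(A /// B) ||| (C /// D) = (A ||| C) /// (B ||| D)"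
  unfolding vec_sum_eq_iff by simp

lemma stack_add [simp]: "(u /// v) + (u' /// v') = (u + u') /// (v + v')"
  by (simp add: vec_sum_eq_iff)

lemma stack_diff [simp]: "(u /// v) - (u' /// v') = (u - u') /// (v - v')"
  by (simp add: vec_sum_eq_iff)

lemma stack_uminus [simp]: "- (u /// v) = - u /// - v"
  by (simp add: vec_sum_eq_iff)

lemma stack_scaleR [simp]: "c *\<^sub>R (u /// v) = c *\<^sub>R u /// c *\<^sub>R v"
  by (simp add: vec_sum_eq_iff)

lemma block_row_add [simp]: "(A ||| B) + (A' ||| B') = (A + A') ||| (B + B')"
  by (simp add: vec_eq_iff)

lemma block_row_diff [simp]: "(A ||| B) - (A' ||| B') = (A - A') ||| (B - B')"
  by (simp add: vec_eq_iff)

lemma block_row_uminus [simp]: "- (A ||| B) = - A ||| - B"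
  by (simp add: vec_eq_iff)

lemma block_row_scaleR [simp]: "c *\<^sub>R (A ||| B) = c *\<^sub>R A ||| c *\<^sub>R B"
  by (simp add: vec_eq_iff)

lemma inner_stack [simp]: "(u /// v) \<bullet> (u' /// v') = u \<bullet> u' + v \<bullet> v'"
  by (simp add: inner_vec_def sum_UNIV_Plus)

lemma stack_mult_vec [simp]: "(A /// B) *v x = (A *v x) /// (B *v x)"
  by (simp add: vec_sum_eq_iff matrix_vector_mult_def)

lemma block_row_mult_vec [simp]: "(A ||| B) *v (u /// v) = A *v u + B *v v"
  by (simp add: vec_eq_iff matrix_vector_mult_def sum_UNIV_Plus)

lemma stack_mult_mat [simp]: "(A /// B) ** C = (A ** C) /// (B ** C)"
  by (simp add: vec_sum_eq_iff matrix_matrix_mult_def)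

lemma mat_mult_block_row [simp]: "A ** (B ||| C) = (A ** B) ||| (A ** C)"
  \<comment> \<open>The instantiation compares rows first; the columns, indexed by the sum type, are
    split afterwards.\<close>
  unfolding vec_eq_iff[of "A ** (B ||| C)"] by (simp add: vec_sum_eq_iff matrix_matrix_mult_def)

lemma block_row_mult_stack [simp]: "(A ||| B) ** (C /// D) = A ** C + B ** D"
  by (simp add: vec_eq_iff matrix_matrix_mult_def sum_UNIV_Plus)

lemma transpose_stack [simp]: "transpose (A /// B) = transpose A ||| transpose B"
  unfolding vec_eq_iff[of "transpose (A /// B)"] by (simp add: vec_sum_eq_iff transpose_def)

lemma transpose_block_row [simp]: "transpose (A ||| B) = transpose A /// transpose B"
  unfolding vec_sum_eq_iff by (simp add: vec_eq_iff transpose_def)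

lemma transpose_zero [simp]: "transpose 0 = 0"
  and transpose_uminus [simp]: "transpose (- A) = - transpose (A :: 'c::group_add^'n^'m)"
  by (simp_all add: vec_eq_iff transpose_def)

lemma transpose_diag [simp]: "transpose (diag v) = diag v"
  by (auto simp: vec_eq_iff transpose_def diag_def)

lemma diag_mult_vec_nth [simp]: "(diag v *v x) $ i = v $ i * x $ i"
  by (simp add: diag_def matrix_vector_mult_def if_distrib if_distribR cong: if_cong)

lemma diag_zero [simp]: "diag 0 = 0"
  and diag_add: "diag (u + v) = diag u + diag v"
  and diag_scaleR: "diag (c *\<^sub>R v) = c *\<^sub>R diag v"
  by (simp_all add: vec_eq_iff diag_def)

lemma inner_diag_nonneg:
  assumes "\<forall>j. 0 \<le> a $ j"
  shows "0 \<le> v \<bullet> (diag a *v v)"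
proof -
  have "v \<bullet> (diag a *v v) = (\<Sum>j\<in>UNIV. a $ j * (v $ j)\<^sup>2)"
    by (simp add: inner_vec_def power2_eq_square mult_ac)
  then show ?thesis
    using assms by (simp add: sum_nonneg)
qed

lemma matrix_mult_uminus_left [simp]: "(- A) ** B = - (A ** (B :: 'a::ring_1^'n^'m))"
  and matrix_mult_uminus_right [simp]: "A ** (- B) = - (A ** (B :: 'a::ring_1^'n^'m))"
  by (simp_all add: vec_eq_iff matrix_matrix_mult_def sum_negf)

lemma uminus_matrix_vector_mult [simp]: "(- A) *v x = - (A *v (x :: 'a::ring_1^'n))"
  and matrix_vector_mult_uminus [simp]: "A *v (- x) = - (A *v (x :: 'a::ring_1^'n))"
  by (simp_all add: vec_eq_iff matrix_vector_mult_def sum_negf)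

section \<open>Congruence and semidefinite block matrices\<close>

text \<open>\<open>transpose Q\<close> is the adjoint of \<open>Q\<close>, so it moves to the other
  side of the inner product.\<close>

lemma quadratic_form_congruence:
  "v \<bullet> ((transpose Q ** R ** Q) *v v) = (Q *v v) \<bullet> (R *v (Q *v (v :: real^'n)))"
  by (metis dot_lmul_matrix inner_commute matrix_vector_mul_assoc transpose_matrix_vector)

lemma pos_semidef_congruence:
  "pos_semidef R \<Longrightarrow> pos_semidef (transpose Q ** R ** Q)"
  by (simp add: pos_semidef_def quadratic_form_congruence matrix_transpose_mul matrix_mul_assoc)

text \<open>The matrix of condition (iii) has this shape when \<open>P = 0\<close> and
  \<open>S = 0\<close>; its form sees only the upper half of the vector.\<close>

lemma pos_semidef_zero_border:
  fixes W :: "real^'a^'a"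
  assumes "pos_semidef W"
  shows "pos_semidef ((W ||| 0) /// (0 ||| 0) :: real^('a + 'b::finite)^('a + 'b))"
  unfolding pos_semidef_def
proof safe
  show "transpose ((W ||| 0) /// (0 ||| 0)) = (W ||| 0) /// (0 ||| 0 :: real^('a + 'b)^'b)"
    using assms by (simp add: pos_semidef_def)
  fix v :: "real^('a + 'b)"
  \<comment> \<open>Writing \<open>v\<close> as a stack exposes it to the block rules;
    \<open>stack_upper_lower\<close> is switched off since it would fold the stack back.\<close>
  have "(upper v /// lower v) \<bullet> (((W ||| 0) /// (0 ||| 0)) *v (upper v /// lower v))
      = upper v \<bullet> (W *v upper v)"
    by (simp del: stack_upper_lower)
  then show "0 \<le> v \<bullet> (((W ||| 0) /// (0 ||| 0)) *v v)"
    using assms by (simp add: pos_semidef_def)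
qed

lemma bounded_linear_upper: "bounded_linear (upper :: real^('a::finite+'b::finite) \<Rightarrow> _)"
  and bounded_linear_lower: "bounded_linear (lower :: real^('a::finite+'b::finite) \<Rightarrow> _)"
  by (auto simp: upper_def lower_def vec_eq_iff intro!: linear_conv_bounded_linear[THEN iffD1] linearI)

text \<open>Uncurried, so that stacking is a single linear map applied to a pair of differentiable
  functions.\<close>

lemma bounded_linear_stack:
  "bounded_linear (\<lambda>(u, v). u /// v :: real^('a::finite+'b::finite))"
  by (auto simp: intro!: linear_conv_bounded_linear[THEN iffD1] linearI)


section \<open>Continuously differentiable functions\<close>

lemma has_C1_derivative_on_bounded_linear:
  assumes "bounded_linear F" "has_C1_derivative_on f f' I"
  shows "has_C1_derivative_on (\<lambda>t. F (f t)) (\<lambda>t. F (f' t)) I"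
  using assms unfolding has_C1_derivative_on_def
  by (auto intro: bounded_linear.continuous_on bounded_linear.has_vector_derivative)

lemma has_C1_derivative_on_const: "has_C1_derivative_on (\<lambda>t. c) (\<lambda>t. 0) I"
  by (simp add: has_C1_derivative_on_def)

text \<open>Derivatives within \<open>I\<close> see only the values on \<open>I\<close>.\<close>

lemma has_C1_derivative_on_cong:
  assumes "has_C1_derivative_on f f' I" "\<And>t. t \<in> I \<Longrightarrow> g t = f t" "\<And>t. t \<in> I \<Longrightarrow> g' t = f' t"
  shows "has_C1_derivative_on g g' I"
  using assms unfolding has_C1_derivative_on_def
  by (metis continuous_on_cong has_vector_derivative_transform)

lemma has_C1_derivative_on_stack:
  fixes f f' :: "real \<Rightarrow> real^'a::finite" and g g' :: "real \<Rightarrow> real^'b::finite"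
  shows "has_C1_derivative_on (\<lambda>t. f t /// g t) (\<lambda>t. f' t /// g' t) I \<longleftrightarrow>
    has_C1_derivative_on f f' I \<and> has_C1_derivative_on g g' I" (is "?L \<longleftrightarrow> ?R")
proof
  assume ?L
  then show ?R
    using has_C1_derivative_on_bounded_linear[OF bounded_linear_upper, of "\<lambda>t. f t /// g t"]
      has_C1_derivative_on_bounded_linear[OF bounded_linear_lower, of "\<lambda>t. f t /// g t"]
    by fastforce
next
  assume ?R
  then have "has_C1_derivative_on (\<lambda>t. (f t, g t)) (\<lambda>t. (f' t, g' t)) I"
    by (auto simp: has_C1_derivative_on_def intro: continuous_on_Pair has_vector_derivative_Pair)
  from has_C1_derivative_on_bounded_linear[OF bounded_linear_stack this] show ?L
    by simp
qed

lemma has_C1_derivative_on_imp_continuous_on: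
  "has_C1_derivative_on f f' I \<Longrightarrow> continuous_on I f"
  unfolding has_C1_derivative_on_def continuous_on_eq_continuous_within
  by (blast intro: has_vector_derivative_continuous)


section \<open>The Kuramoto system\<close>

lemma coupling_nth [simp]: "coupling K $ i $ j = K"
  by (simp add: coupling_def matrix_matrix_mult_def columnvector_def rowvector_def)

lemma transpose_coupling [simp]: "transpose (coupling K) = coupling K"
  by (simp add: vec_eq_iff transpose_def)

text \<open>The coupling matrix is the rank-one matrix K e e^T, whose form at v is K (e .
  v)^2.\<close>

lemma inner_coupling: "v \<bullet> (coupling K *v v) = K * (\<Sum>j\<in>UNIV. v $ j)\<^sup>2"
  by (simp add: inner_vec_def matrix_vector_mult_def power2_eq_square
      flip: sum_distrib_left sum_distrib_right)

section \<open>The first integral and the equivalence of (A) and (B)\<close>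

text \<open>The derivative is 2 (-\<rho>_j \<sigma>_j \<omega>_j + \<sigma>_j \<rho>_j \<omega>_j) =
  0, and a function with zero derivative on an interval is constant. The lemma is stated for the two
  kinematic equations that (A) and (B) share, so it serves both.\<close>

lemma circle_invariant:
  fixes \<rho> \<sigma> \<omega> :: "real \<Rightarrow> real^'n"
  assumes "is_interval I" "t0 \<in> I" "t \<in> I"
    and "has_C1_derivative_on \<rho> \<rho>' I" "has_C1_derivative_on \<sigma> \<sigma>' I"
    and "\<And>t. t \<in> I \<Longrightarrow> \<rho>' t = - (diag (\<sigma> t) *v \<omega> t)"
    and "\<And>t. t \<in> I \<Longrightarrow> \<sigma>' t = diag (\<rho> t) *v \<omega> t"
    and init: "(\<rho> t0 $ j)\<^sup>2 + (\<sigma> t0 $ j)\<^sup>2 = 1"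
  shows "(\<rho> t $ j)\<^sup>2 + (\<sigma> t $ j)\<^sup>2 = 1"
proof -
  have "((\<lambda>t. (\<rho> t $ j)\<^sup>2 + (\<sigma> t $ j)\<^sup>2) has_field_derivative 0) (at s within I)" if "s \<in> I" for s
  proof -
    \<comment> \<open>Coordinate projection is bounded linear; it turns the vector derivative into a
      real one, on which the product rules operate.\<close>
    have comp: "((\<lambda>t. f t $ j) has_field_derivative f' s $ j) (at s within I)"
      if "has_C1_derivative_on f f' I" for f f' :: "real \<Rightarrow> real^'n"
      using that \<open>s \<in> I\<close>
        has_C1_derivative_on_bounded_linear[OF bounded_linear_vec_nth, of f f' I j]
      by (simp add: has_C1_derivative_on_def has_real_derivative_iff_has_vector_derivative)
    show ?thesis
      by (rule derivative_eq_intros comp assms refl | simp add: assms \<open>s \<in> I\<close>)+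
  qed
  then obtain c where "\<And>s. s \<in> I \<Longrightarrow> (\<rho> s $ j)\<^sup>2 + (\<sigma> s $ j)\<^sup>2 = c"
    using has_field_derivative_zero_constant[of I "\<lambda>t. (\<rho> t $ j)\<^sup>2 + (\<sigma> t $ j)\<^sup>2"] assms(1)
    by (auto simp: is_interval_convex)
  then show ?thesis
    using assms by metis
qed

lemma circle_constraint_iff:
  "0 = diag \<rho> *v \<rho> + diag \<sigma> *v \<sigma> - \<mu> \<longleftrightarrow> (\<forall>j. \<mu> $ j = (\<rho> $ j)\<^sup>2 + (\<sigma> $ j)\<^sup>2)"
  by (auto simp: vec_eq_iff power2_eq_square)

text \<open>In both directions the first integral turns the constraint into \<mu> = 1. From (B) this
  makes \<mu> constant; conversely, a constant \<mu> equals its initial value 1.\<close>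

lemma solves_B_iff_solves_A:
  assumes "is_interval I" "t0 \<in> I"
    and init: "\<forall>j. (\<rho> t0 $ j)\<^sup>2 + (\<sigma> t0 $ j)\<^sup>2 = 1" and \<mu>0: "\<mu> t0 = 1"
  shows "solves_B I m d K \<Omega> \<omega> \<rho> \<sigma> \<mu> \<longleftrightarrow> solves_A I m d K \<Omega> \<omega> \<rho> \<sigma> \<and> \<mu> constant_on I"
proof
  assume B: "solves_B I m d K \<Omega> \<omega> \<rho> \<sigma> \<mu>"
  then have A: "solves_A I m d K \<Omega> \<omega> \<rho> \<sigma>"
    unfolding solves_B_def solves_A_def by blast
  then have "\<And>t j. t \<in> I \<Longrightarrow> (\<rho> t $ j)\<^sup>2 + (\<sigma> t $ j)\<^sup>2 = 1"
    unfolding solves_A_def using circle_invariant[OF assms(1,2)] init by blast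
  with B have "\<And>t. t \<in> I \<Longrightarrow> \<mu> t = 1"
    unfolding solves_B_def circle_constraint_iff by (auto simp: vec_eq_iff)
  with A show "solves_A I m d K \<Omega> \<omega> \<rho> \<sigma> \<and> \<mu> constant_on I"
    by (auto simp: constant_on_def)
next
  assume A: "solves_A I m d K \<Omega> \<omega> \<rho> \<sigma> \<and> \<mu> constant_on I"
  then have \<mu>: "\<mu> t = 1" if "t \<in> I" for t
    using \<mu>0 assms(2) that by (metis constant_on_def)
  have "\<And>t j. t \<in> I \<Longrightarrow> (\<rho> t $ j)\<^sup>2 + (\<sigma> t $ j)\<^sup>2 = 1"
    using A unfolding solves_A_def using circle_invariant[OF assms(1,2)] init by blast
  \<comment> \<open>Differentiability of \<mu> is part of (B) but not of (A); constancy on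
    \<open>I\<close> supplies the derivative 0.\<close>
  moreover have "has_C1_derivative_on \<mu> (\<lambda>t. 0) I"
    by (rule has_C1_derivative_on_cong[OF has_C1_derivative_on_const[of 1]]) (auto simp: \<mu>)
  ultimately have constraint: "has_C1_derivative_on \<mu> (\<lambda>t. 0) I"
    "\<forall>t\<in>I. 0 = diag (\<rho> t) *v \<rho> t + diag (\<sigma> t) *v \<sigma> t - \<mu> t"
    unfolding circle_constraint_iff using \<mu> by simp_all
  obtain \<omega>' \<rho>' \<sigma>' where "has_C1_derivative_on \<omega> \<omega>' I" "has_C1_derivative_on \<rho> \<rho>' I"
    "has_C1_derivative_on \<sigma> \<sigma>' I"
    "\<forall>t\<in>I. diag m *v \<omega>' t = \<Omega> - diag d *v \<omega> t - diag (\<sigma> t) *v (coupling K *v \<rho> t)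
                           + diag (\<rho> t) *v (coupling K *v \<sigma> t) \<and>
      \<rho>' t = - (diag (\<sigma> t) *v \<omega> t) \<and> \<sigma>' t = diag (\<rho> t) *v \<omega> t"
    using A unfolding solves_A_def by (elim conjE exE)
  with constraint show "solves_B I m d K \<Omega> \<omega> \<rho> \<sigma> \<mu>"
    unfolding solves_B_def
    by (intro exI[of _ \<omega>'] exI[of _ \<rho>'] exI[of _ \<sigma>'] exI[of _ "\<lambda>t. 0"]) simp
qed

section \<open>The port-Hamiltonian form of (B)\<close>

text \<open>The last block of Qx is the residual of the constraint. There E and J vanish and R is
  the identity, so the last block row of the system says that the residual is 0; the other rows are
  the differential equations.\<close>

lemma pHDAE_solution_iff_solves_B:
  fixes m d \<Omega> :: "real^'n" and \<omega> \<rho> \<sigma> \<mu> :: "real \<Rightarrow> real^'n"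
  shows "pHDAE_solution I (\<lambda>t. E_tilde m) (\<lambda>t. Q_tilde K (\<rho> t) (\<sigma> t)) (\<lambda>t. J_tilde (\<rho> t) (\<sigma> t))
     (\<lambda>t. R_tilde d) (\<lambda>t. 0) (\<lambda>t. B_tilde) (\<lambda>t. 0) (\<lambda>t. 0) (\<lambda>t. 0)
     (\<lambda>t. \<Omega>) (\<lambda>t. \<omega> t /// \<rho> t /// \<sigma> t /// \<mu> t) y \<longleftrightarrow>
   solves_B I m d K \<Omega> \<omega> \<rho> \<sigma> \<mu> \<and>
   (\<forall>t\<in>I. y t = (transpose B_tilde ** Q_tilde K (\<rho> t) (\<sigma> t))
                   *v (\<omega> t /// \<rho> t /// \<sigma> t /// \<mu> t))"
proof -
  let ?x = "\<lambda>t. \<omega> t /// \<rho> t /// \<sigma> t /// \<mu> t"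
  have Q: "Q_tilde K (\<rho> t) (\<sigma> t) *v ?x t =
      \<omega> t /// - (coupling K *v \<rho> t) /// - (coupling K *v \<sigma> t) ///
      diag (\<rho> t) *v \<rho> t + diag (\<sigma> t) *v \<sigma> t - \<mu> t" for t
    by (simp add: Q_tilde_def add.assoc)
  have dyn: "E_tilde m *v (a /// b /// c /// e)
      = ((J_tilde (\<rho> t) (\<sigma> t) - R_tilde d) ** Q_tilde K (\<rho> t) (\<sigma> t) - E_tilde m ** 0) *v ?x t
        + (B_tilde - 0) *v \<Omega> \<longleftrightarrow>
      diag m *v a = \<Omega> - diag d *v \<omega> t - diag (\<sigma> t) *v (coupling K *v \<rho> t)
                      + diag (\<rho> t) *v (coupling K *v \<sigma> t) \<and>
      b = - (diag (\<sigma> t) *v \<omega> t) \<and>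
      c = diag (\<rho> t) *v \<omega> t \<and>
      0 = diag (\<rho> t) *v \<rho> t + diag (\<sigma> t) *v \<sigma> t - \<mu> t" for a b c e t
    \<comment> \<open>Associating to the right applies Q to the state first, so the vector computed
      in \<open>Q\<close> can be inserted.\<close>
    unfolding matrix_vector_mult_diff_rdistrib matrix_vector_mul_assoc[symmetric] Q
    by (auto simp: E_tilde_def J_tilde_def R_tilde_def B_tilde_def algebra_simps)
  \<comment> \<open>One derivative of the whole state is traded for four derivatives of its
    blocks.\<close>
  have split4: "(\<exists>x'. P x') \<longleftrightarrow> (\<exists>a b c e. P (\<lambda>t. a t /// b t /// c t /// e t))"
    for P :: "(real \<Rightarrow> real^('n + 'n + 'n + 'n)) \<Rightarrow> bool"
  proof
    assume "\<exists>x'. P x'"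
    then obtain x' where "P x'" ..
    then show "\<exists>a b c e. P (\<lambda>t. a t /// b t /// c t /// e t)"
      by (intro exI[of _ "\<lambda>t. upper (x' t)"] exI[of _ "\<lambda>t. upper (lower (x' t))"]
          exI[of _ "\<lambda>t. upper (lower (lower (x' t)))"] exI[of _ "\<lambda>t. lower (lower (lower (x' t)))"])
        simp
  qed blast
  show ?thesis
    unfolding pHDAE_solution_def solves_B_def split4 dyn has_C1_derivative_on_stack ball_conj_distrib
    by simp blast
qed

section \<open>Algebraic structure of the coefficients\<close>

lemma transpose_J_tilde: "transpose (J_tilde \<rho> \<sigma>) = - J_tilde \<rho> \<sigma>"
  by (simp add: J_tilde_def)

text \<open>Transposition moves the state-dependent block row of Q into the last block column, which
  meets the zero block row of E.\<close>

lemma transpose_Q_tilde_mult_E_tilde: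
  "transpose (Q_tilde K \<rho> \<sigma>) ** E_tilde m =
    ((diag m ||| 0 ||| 0 ||| 0) ///
     (0 ||| - coupling K ||| 0 ||| 0) ///
     (0 ||| 0 ||| - coupling K ||| 0) ///
     (0 ||| 0 ||| 0 ||| 0))"
  by (simp add: Q_tilde_def E_tilde_def)

lemma transpose_E_tilde_mult_Q_tilde:
  "transpose (E_tilde m) ** Q_tilde K \<rho> \<sigma> = transpose (Q_tilde K \<rho> \<sigma>) ** E_tilde m"
  by (simp add: Q_tilde_def E_tilde_def)

text \<open>With outer blocks v1 and v4 of v, the form is v1 . D v1 + v4 . v4.\<close>

lemma pos_semidef_R_tilde:
  fixes d :: "real^'n"
  assumes "\<forall>j. 0 < d $ j"
  shows "pos_semidef (R_tilde d)"
  unfolding pos_semidef_def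
proof safe
  show "transpose (R_tilde d) = R_tilde d"
    by (simp add: R_tilde_def)
  fix v :: "real^('n + 'n + 'n + 'n)"
  have "0 \<le> upper v \<bullet> (diag d *v upper v)"
    using assms by (simp add: inner_diag_nonneg less_imp_le)
  then have "0 \<le> (upper v /// upper (lower v) /// upper (lower (lower v)) /// lower (lower (lower v)))
    \<bullet> (R_tilde d *v (upper v /// upper (lower v) /// upper (lower (lower v)) /// lower (lower (lower v))))"
    by (simp add: R_tilde_def del: stack_upper_lower)
  then show "0 \<le> v \<bullet> (R_tilde d *v v)"
    by simp
qed

section \<open>The Hamiltonian and its lower bound\<close>

text \<open>The arguments of \<open>Q_tilde\<close> are kept apart from the blocks of the state
  because they cancel in \<open>transpose Q ** E\<close>.\<close>

lemma hamiltonian_tilde: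
  "hamiltonian (E_tilde m) (Q_tilde K \<rho> \<sigma>) (\<omega> /// \<rho>' /// \<sigma>' /// \<mu>) =
    1/2 * (\<omega> \<bullet> (diag m *v \<omega>)) - 1/2 * (\<rho>' \<bullet> (coupling K *v \<rho>'))
    - 1/2 * (\<sigma>' \<bullet> (coupling K *v \<sigma>'))"
  by (simp add: hamiltonian_def transpose_Q_tilde_mult_E_tilde algebra_simps)

text \<open>The kinetic term is nonnegative. On the circles all entries have modulus at most 1, so
  the entries of \<rho> and of \<sigma> each sum to at most n in modulus; each potential term is
  then at least -K n^2 / 2.\<close>

lemma hamiltonian_lower_bound:
  fixes \<omega> \<rho> \<sigma> \<mu> :: "real^'n"
  assumes "0 < K" "\<forall>j. 0 < m $ j" and circle: "\<And>j. (\<rho> $ j)\<^sup>2 + (\<sigma> $ j)\<^sup>2 = 1"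
  shows "- K * (real CARD('n))\<^sup>2 \<le> hamiltonian (E_tilde m) (Q_tilde K \<rho> \<sigma>) (\<omega> /// \<rho> /// \<sigma> /// \<mu>)"
proof -
  have "0 \<le> \<omega> \<bullet> (diag m *v \<omega>)"
    using assms by (simp add: inner_diag_nonneg less_imp_le)
  have bound: "v \<bullet> (coupling K *v v) \<le> K * (real CARD('n))\<^sup>2"
    if "\<And>j. \<bar>v $ j\<bar> \<le> 1" for v :: "real^'n"
  proof -
    have "\<bar>\<Sum>j\<in>UNIV. v $ j\<bar> \<le> (\<Sum>j\<in>(UNIV::'n set). 1)"
      by (rule order_trans[OF sum_abs sum_mono]) (use that in auto)
    then have "(\<Sum>j\<in>UNIV. v $ j)\<^sup>2 \<le> (real CARD('n))\<^sup>2"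
      by (simp add: abs_le_square_iff[symmetric])
    then show ?thesis
      using assms by (simp add: inner_coupling)
  qed
  have "\<bar>\<rho> $ j\<bar> \<le> 1" "\<bar>\<sigma> $ j\<bar> \<le> 1" for j
    using circle[of j] zero_le_power2[of "\<rho> $ j"] zero_le_power2[of "\<sigma> $ j"]
    unfolding abs_square_le_1[symmetric] by linarith+
  from this[THEN bound] show ?thesis
    using \<open>0 \<le> \<omega> \<bullet> (diag m *v \<omega>)\<close> unfolding hamiltonian_tilde by simp
qed

section \<open>Regularity of the coefficients and conditions (i) and (iii)\<close>

lemma rho_of_linear: "rho_of (x + y) = rho_of x + rho_of y" "rho_of (c *\<^sub>R x) = c *\<^sub>R rho_of x"
  and sigma_of_linear: "sigma_of (x + y) = sigma_of x + sigma_of y"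
    "sigma_of (c *\<^sub>R x) = c *\<^sub>R sigma_of x"
  by (simp_all add: vec_eq_iff rho_of_def sigma_of_def upper_def lower_def)

lemma bounded_linear_J_tilde: "bounded_linear (\<lambda>x. J_tilde (rho_of x) (sigma_of x))"
  by (intro linear_conv_bounded_linear[THEN iffD1] linearI)
    (simp_all add: J_tilde_def diag_add diag_scaleR rho_of_linear sigma_of_linear)

text \<open>Q is only affine in the state; subtracting its value at 0 leaves the linear part with
  blocks D_\<rho> and D_\<sigma>.\<close>

lemma bounded_linear_Q_tilde:
  "bounded_linear (\<lambda>x. Q_tilde K (rho_of x) (sigma_of x) - Q_tilde K 0 0)"
  by (intro linear_conv_bounded_linear[THEN iffD1] linearI)
    (simp_all add: Q_tilde_def diag_add diag_scaleR rho_of_linear sigma_of_linear)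

lemma C1_on_Q_tilde:
  assumes "has_C1_derivative_on x x' I"
  shows "C1_on I (\<lambda>t. Q_tilde K (rho_of (x t)) (sigma_of (x t)))"
proof -
  let ?L = "\<lambda>x. Q_tilde K (rho_of x) (sigma_of x) - Q_tilde K 0 0"
  have "has_C1_derivative_on (\<lambda>t. ?L (x t)) (\<lambda>t. ?L (x' t)) I"
    by (rule has_C1_derivative_on_bounded_linear[OF bounded_linear_Q_tilde assms])
  then have "has_C1_derivative_on (\<lambda>t. ?L (x t) + Q_tilde K 0 0) (\<lambda>t. ?L (x' t)) I"
    unfolding has_C1_derivative_on_def has_vector_derivative_add_const .
  then show ?thesis
    by (auto simp: C1_on_def)
qed

text \<open>Conditions (i) and (iii) rest on matrix facts valid at every state, so any C1 curve
  \<open>x\<close> can be inserted; Q and J inherit their regularity from it.\<close>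

lemma pHDAE_coefficients_tilde:
  fixes m d :: "real^'n"
  assumes d: "\<forall>j. 0 < d $ j" and x: "has_C1_derivative_on x x' I"
  shows "pHDAE_coefficients I (\<lambda>t. E_tilde m) (\<lambda>t. Q_tilde K (rho_of (x t)) (sigma_of (x t)))
    (\<lambda>t. J_tilde (rho_of (x t)) (sigma_of (x t))) (\<lambda>t. R_tilde d) (\<lambda>t. 0) (\<lambda>t. B_tilde)
    (\<lambda>t. 0) (\<lambda>t. 0) (\<lambda>t. 0)"
proof -
  let ?Q = "\<lambda>t. Q_tilde K (rho_of (x t)) (sigma_of (x t))"
  let ?J = "\<lambda>t. J_tilde (rho_of (x t)) (sigma_of (x t))"
  have J: "continuous_on I ?J"
    by (rule bounded_linear.continuous_on[OF bounded_linear_J_tilde])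
      (rule has_C1_derivative_on_imp_continuous_on[OF x])
  have E: "C1_on I (\<lambda>t. E_tilde m)"
    using has_C1_derivative_on_const by (auto simp: C1_on_def)
  have QE: "has_C1_derivative_on (\<lambda>t. transpose (?Q t) ** E_tilde m)
      (\<lambda>t. transpose (?Q t) ** (E_tilde m ** 0 - ?J t ** ?Q t)
        + transpose (E_tilde m ** 0 - ?J t ** ?Q t) ** ?Q t) I"
  proof (rule has_C1_derivative_on_cong[OF has_C1_derivative_on_const])
    show "transpose (?Q t) ** E_tilde m = transpose (Q_tilde K 0 0) ** E_tilde m" for t
      by (simp add: transpose_Q_tilde_mult_E_tilde)
    \<comment> \<open>The sum is -Q^T (J + J^T) Q, which vanishes by skew-symmetry.\<close>
    show "transpose (?Q t) ** (E_tilde m ** 0 - ?J t ** ?Q t)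
        + transpose (E_tilde m ** 0 - ?J t ** ?Q t) ** ?Q t = 0" for t
      by (simp add: matrix_transpose_mul matrix_mul_assoc transpose_J_tilde)
  qed
  have W: "pos_semidef ((transpose (?Q t) ** R_tilde d ** ?Q t ||| transpose (?Q t) ** 0) ///
      (transpose 0 ** ?Q t ||| 0))" for t
    by (simp add: pos_semidef_zero_border pos_semidef_congruence pos_semidef_R_tilde[OF d])
  show ?thesis
    unfolding pHDAE_coefficients_def
    by (intro conjI ballI E J QE W C1_on_Q_tilde[OF x] continuous_on_const)
      (simp_all add: transpose_E_tilde_mult_Q_tilde)
qed

section \<open>Assembly of the pHDAE property and of the theorem\<close>

text \<open>The initial set enters through condition (ii): it puts each (\<rho>_j, \<sigma>_j) on
  the unit circle at \<open>t0\<close>, and the first integral keeps it there on all of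
  \<open>I\<close>.\<close>

lemma pHDAE_tilde:
  fixes m d \<Omega> :: "real^'n"
  assumes "0 < K" "\<forall>j. 0 < m $ j" "\<forall>j. 0 < d $ j" "is_interval I" "t0 \<in> I"
  shows "pHDAE I t0 initial_states
       (\<lambda>t x. E_tilde m) (\<lambda>t x. Q_tilde K (rho_of x) (sigma_of x))
       (\<lambda>t x. J_tilde (rho_of x) (sigma_of x)) (\<lambda>t x. R_tilde d) (\<lambda>t x. 0)
       (\<lambda>t x. B_tilde) (\<lambda>t x. 0) (\<lambda>t x. 0) (\<lambda>t x. 0) (\<lambda>t. \<Omega>)"
proof -
  let ?sol = "\<lambda>x y. pHDAE_solution I (\<lambda>t. E_tilde m)
    (\<lambda>t. Q_tilde K (rho_of (x t)) (sigma_of (x t)))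
    (\<lambda>t. J_tilde (rho_of (x t)) (sigma_of (x t))) (\<lambda>t. R_tilde d) (\<lambda>t. 0) (\<lambda>t. B_tilde)
    (\<lambda>t. 0) (\<lambda>t. 0) (\<lambda>t. 0) (\<lambda>t. \<Omega>) x y"
  have coeffs: "pHDAE_coefficients I (\<lambda>t. E_tilde m)
    (\<lambda>t. Q_tilde K (rho_of (x t)) (sigma_of (x t)))
    (\<lambda>t. J_tilde (rho_of (x t)) (sigma_of (x t))) (\<lambda>t. R_tilde d) (\<lambda>t. 0) (\<lambda>t. B_tilde)
    (\<lambda>t. 0) (\<lambda>t. 0) (\<lambda>t. 0)" if "?sol x y" for x y
    using that pHDAE_coefficients_tilde[OF assms(3)] unfolding pHDAE_solution_def by blast
  have bound: "- K * (real CARD('n))\<^sup>2 \<le>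
      hamiltonian (E_tilde m) (Q_tilde K (rho_of (x t)) (sigma_of (x t))) (x t)"
    if sol: "?sol x y" and x0: "x t0 \<in> initial_states" and "t \<in> I" for x y t
  proof -
    define \<omega> \<rho> \<sigma> \<mu> where "\<omega> = (\<lambda>t. upper (x t))" and "\<rho> = (\<lambda>t. rho_of (x t))"
      and "\<sigma> = (\<lambda>t. sigma_of (x t))" and "\<mu> = (\<lambda>t. lower (lower (lower (x t))))"
    have x: "x = (\<lambda>t. \<omega> t /// \<rho> t /// \<sigma> t /// \<mu> t)"
      by (simp add: \<omega>_def \<rho>_def \<sigma>_def \<mu>_def rho_of_def sigma_of_def)
    have \<rho>\<sigma>: "rho_of (x t) = \<rho> t" "sigma_of (x t) = \<sigma> t" for t
      by (simp_all add: \<rho>_def \<sigma>_def)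
    have "solves_B I m d K \<Omega> \<omega> \<rho> \<sigma> \<mu>"
      \<comment> \<open>The order matters: the projections are replaced while the state is still the
        variable \<open>x\<close>; expanding \<open>x\<close> first would put the stack under
        them.\<close>
      using sol unfolding \<rho>\<sigma> unfolding x pHDAE_solution_iff_solves_B ..
    moreover have "(\<rho> t0 $ j)\<^sup>2 + (\<sigma> t0 $ j)\<^sup>2 = 1" for j
      using x0 unfolding initial_states_def x by auto
    ultimately have "(\<rho> t $ j)\<^sup>2 + (\<sigma> t $ j)\<^sup>2 = 1" for j
      unfolding solves_B_def using circle_invariant[OF assms(4,5) \<open>t \<in> I\<close>] by blast
    from hamiltonian_lower_bound[OF assms(1,2) this] show ?thesis
      unfolding \<rho>\<sigma> unfolding x .
  qed
  show ?thesis
    unfolding pHDAE_def along_def Let_def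
    \<comment> \<open>The witness for h0 depends only on K and n, hence is uniform over solutions
      and times.\<close>
    by (intro conjI ballI exI[of _ "- K * (real CARD('n))\<^sup>2"]; elim CollectE conjE exE)
      (erule coeffs, rule bound)
qed

theorem mainTheorem1:
  fixes m d \<Omega> :: "real^'n" and K t0 :: real and I :: "real set"
  assumes "K > 0"
    and "\<forall>j. m $ j > 0"
    and "\<forall>j. d $ j > 0"
    and "is_interval I" and "compact I" and "t0 \<in> I"
  shows
    "(\<forall>\<omega> \<rho> \<sigma> \<mu>.
        (\<forall>j. (\<rho> t0 $ j)\<^sup>2 + (\<sigma> t0 $ j)\<^sup>2 = 1) \<and> \<mu> t0 = 1 \<longrightarrow>
        (solves_B I m d K \<Omega> \<omega> \<rho> \<sigma> \<mu> \<longleftrightarrow>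
         solves_A I m d K \<Omega> \<omega> \<rho> \<sigma> \<and> \<mu> constant_on I)) \<and>
     (\<forall>\<omega> \<rho> \<sigma> \<mu> y.
        pHDAE_solution I (\<lambda>t. E_tilde m) (\<lambda>t. Q_tilde K (\<rho> t) (\<sigma> t)) (\<lambda>t. J_tilde (\<rho> t) (\<sigma> t))
          (\<lambda>t. R_tilde d) (\<lambda>t. 0) (\<lambda>t. B_tilde) (\<lambda>t. 0) (\<lambda>t. 0) (\<lambda>t. 0)
          (\<lambda>t. \<Omega>) (\<lambda>t. \<omega> t /// \<rho> t /// \<sigma> t /// \<mu> t) y \<longleftrightarrow>
        solves_B I m d K \<Omega> \<omega> \<rho> \<sigma> \<mu> \<and>
        (\<forall>t\<in>I. y t = (transpose B_tilde ** Q_tilde K (\<rho> t) (\<sigma> t))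
                        *v (\<omega> t /// \<rho> t /// \<sigma> t /// \<mu> t))) \<and>
     pHDAE I t0 initial_states
       (\<lambda>t x. E_tilde m) (\<lambda>t x. Q_tilde K (rho_of x) (sigma_of x))
       (\<lambda>t x. J_tilde (rho_of x) (sigma_of x)) (\<lambda>t x. R_tilde d) (\<lambda>t x. 0)
       (\<lambda>t x. B_tilde) (\<lambda>t x. 0) (\<lambda>t x. 0) (\<lambda>t x. 0) (\<lambda>t. \<Omega>) \<and>
     (\<forall>\<rho> \<sigma> :: real \<Rightarrow> real^'n.
        (\<forall>t\<in>I. J_tilde (\<rho> t) (\<sigma> t) = - transpose (J_tilde (\<rho> t) (\<sigma> t))) \<and>
        (\<forall>t\<in>I. transpose (Q_tilde K (\<rho> t) (\<sigma> t)) ** E_tilde m =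
                transpose (E_tilde m) ** Q_tilde K (\<rho> t) (\<sigma> t)) \<and>
        (\<lambda>t. transpose (Q_tilde K (\<rho> t) (\<sigma> t)) ** E_tilde m) constant_on I \<and>
        (\<forall>t\<in>I. pos_semidef
          (transpose (Q_tilde K (\<rho> t) (\<sigma> t)) ** R_tilde d ** Q_tilde K (\<rho> t) (\<sigma> t)))) \<and>
     (\<forall>\<omega> \<rho> \<sigma> \<mu> :: real^'n.
        hamiltonian (E_tilde m) (Q_tilde K \<rho> \<sigma>) (\<omega> /// \<rho> /// \<sigma> /// \<mu>) =
          1/2 * (\<omega> \<bullet> (diag m *v \<omega>)) - 1/2 * (\<rho> \<bullet> (coupling K *v \<rho>))
          - 1/2 * (\<sigma> \<bullet> (coupling K *v \<sigma>)))"
proof (intro conjI allI impI ballI)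
  fix \<omega> \<rho> \<sigma> \<mu> :: "real \<Rightarrow> real^'n"
  assume "(\<forall>j. (\<rho> t0 $ j)\<^sup>2 + (\<sigma> t0 $ j)\<^sup>2 = 1) \<and> \<mu> t0 = 1"
  then show "solves_B I m d K \<Omega> \<omega> \<rho> \<sigma> \<mu> \<longleftrightarrow>
      solves_A I m d K \<Omega> \<omega> \<rho> \<sigma> \<and> \<mu> constant_on I"
    using solves_B_iff_solves_A[OF assms(4,6)] by blast
next
  show "pHDAE I t0 initial_states
       (\<lambda>t x. E_tilde m) (\<lambda>t x. Q_tilde K (rho_of x) (sigma_of x))
       (\<lambda>t x. J_tilde (rho_of x) (sigma_of x)) (\<lambda>t x. R_tilde d) (\<lambda>t x. 0)
       (\<lambda>t x. B_tilde) (\<lambda>t x. 0) (\<lambda>t x. 0) (\<lambda>t x. 0) (\<lambda>t. \<Omega>)"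
    by (rule pHDAE_tilde[OF assms(1-4,6)])
next
  fix \<rho> \<sigma> :: "real \<Rightarrow> real^'n"
  show "(\<lambda>t. transpose (Q_tilde K (\<rho> t) (\<sigma> t)) ** E_tilde m) constant_on I"
    by (auto simp: constant_on_def transpose_Q_tilde_mult_E_tilde)
qed (rule pHDAE_solution_iff_solves_B hamiltonian_tilde transpose_E_tilde_mult_Q_tilde[symmetric]
    pos_semidef_congruence[OF pos_semidef_R_tilde[OF assms(3)]] | simp add: transpose_J_tilde)+

end
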